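(* Consider stochastic dynamic teams $(\mathcal{P}^D)$ with partially nested information structure, in which $\hat y^D_i=g_i(h_i(\zeta),u^D_{\downarrow i})$, such that for all $i\in\mathcal{N}$ and every fixed $u^D_{\downarrow i}$ the function $g_i(\cdot,u^D_{\downarrow i}):h_i(\zeta)\mapsto\hat y^D_i$ is invertible for all realizations of $\zeta$. Let $\underline\gamma^{D*}\in\Gamma^D$ and $\underline\gamma^{S*}\in\Gamma^S$ be related by the policy-dependent static reduction, i.e. $u^i=\gamma^{S*}_i(y^S_i)=\gamma^{D*}_i(y^D_i)$ $P$-a.s. for all $i\in\mathcal{N}$. Then: (i) If $\underline\gamma^{D*}$ is stationary (respectively, pbp optimal) for $(\mathcal{P}^D)$, then $\underline\gamma^{S*}$ is not necessarily stationary (respectively, pbp optimal) for $(\mathcal{P}^S)$; that is, there exist such a team and such a pair $(\underline\gamma^{D*},\underline\gamma^{S*})$ for which the implication fails. (ii) If $\underline\gamma^{S*}$ is stationary (respectively, pbp optimal) for $(\mathcal{P}^S)$, then $\underline\gamma^{D*}$ is not necessarily pbp optimal for $(\mathcal{P}^D)$; that is, there exist such a team and such a pair for which the implication fails.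
   Context: Setting. $\mathcal{N}=\{1,\dots,N\}$; the decision makers DM$^1,\dots,$DM$^N$ act in this order, each once. Action spaces $\mathbb{U}^i\subseteq\mathbb{R}^{n_i}$ and observation spaces are Borel subsets of Euclidean spaces. $\zeta=\{\omega_0,\dots,\omega_N\}$ is the collection of all primitive random variables on $(\Omega,\mathcal{F},P)$, $\omega_0$ taking values in a Borel space $\Omega_0$. The cost is a Borel function $c:\Omega_0\times\prod_i\mathbb{U}^i\to\mathbb{R}_+$, and $J(\underline\gamma)=E[c(\omega_0,u^1,\dots,u^N)]$ when actions are generated by $\underline\gamma$. All policies are deterministic. Dynamic team $(\mathcal{P}^D)$. DM$^i$ has information $I^i_D=\{y^D_i\}$, $y^D_i=\{y^D_{\downarrow i},\hat y^D_i\}$, $\hat y^D_i=g_i(h_i(\zeta),u^D_{\downarrow i})$, with $g_i,h_i$ measurable, $\downarrow i=\{j: \hat y^D_i\text{ is affected by }u^j\}$, $y^D_{\downarrow i}=(y^D_j)_{j\in\downarrow i}$ and $u^D_{\downarrow i}=(u^D_j)_{j\in\downarrow i}$. Thus the information structure is partially nested: whenever the action of DM$^k$, $k<i$, affects the information of DM$^i$, the information of DM$^i$ includes that of DM$^k$. $\Gamma^D$ is the set of policies $\underline\gamma^D=(\gamma^D_1,\dots,\gamma^D_N)$, $\gamma^D_i$ measurable, with $u^D_i=\gamma^D_i(y^D_i)$. Static team $(\mathcal{P}^S)$. Same cost; DM$^i$ has information $I^i_S=\{y^S_i\}$, $y^S_i=\{y^S_{\downarrow i},\hat y^S_i\}$,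 $\hat y^S_i=h_i(\zeta)$; $\Gamma^S$ is the set of policies $\underline\gamma^S$ with $u^S_i=\gamma^S_i(y^S_i)$. Under the invertibility assumption, given the policies of the preceding DMs, there is a bijection between $y^D_i$ and $y^S_i$ (via $h_i(\zeta)=g_i^{-1}(\hat y^D_i,\gamma^D_{\downarrow i}(y^D_{\downarrow i}))$), so each $\underline\gamma^D\in\Gamma^D$ yields $\underline\gamma^S\in\Gamma^S$, and conversely, through $\gamma^S_i(y^S_i)=\gamma^D_i(y^D_i)$ $P$-a.s. for all $i$; this is the policy-dependent static reduction. Optimality concepts. $\underline\gamma^*$ is pbp (person-by-person) optimal for a problem if, for every $i$, $J(\underline\gamma^* )=\inf_{\gamma_i}J(\gamma_i,\underline\gamma^*_{-i})$, the infimum being over admissible policies of DM$^i$ in that problem ($\Gamma^D_i$ or $\Gamma^S_i$) with the other policies $\underline\gamma^*_{-i}$ fixed. $\underline\gamma^*$ is stationary if for every $i$, $P$-a.s., $\nabla_{u^i}E[c(\omega_0,(\underline\gamma^*_{-i}(y_{-i}),u^i))\mid y_i]|_{u^i=\gamma^*_i(y_i)}=0$, where $y_j$ is $y^D_j$ or $y^S_j$ according to the problem; in $(\mathcal{P}^D)$ the observations $y^D_j$ of later DMs that are affected by the action of DM$^i$ are evaluated with that action equal to $u^i$, whereas in $(\mathcal{P}^S)$ observations do not depend on $u^i$. *)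

theory Defs
  imports "HOL-Probability.Probability"
begin

text \<open>
  The dimensions of the action and observation spaces vary with the decision maker, so points of
  \<open>\<real>\<^sup>n\<close> are functions in \<open>{..<n} \<rightarrow>\<^sub>E UNIV\<close>. Decision makers are
  numbered \<open>1, \<dots>, N\<close>; the primitive random variables are numbered \<open>0, \<dots>, N\<close>.
\<close>

type_synonym rvec = "nat \<Rightarrow> real"

definition euclid :: "nat \<Rightarrow> rvec measure" where
  "euclid n = Pi\<^sub>M {..<n} (\<lambda>_. borel)"

text \<open>
  The Borel spaces in which the primitive random variables live are Borel subsets of a Polish
  space \<^typ>\<open>'z\<close>. One record holds the data of the dynamic team and of its static counterpart.
  In \<open>obs_fun T i x u\<close> (the paper's \<open>g\<^sub>i(x, u)\<close>), the argument \<open>u\<close> is the tuple of the actions of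
  the decision makers in \<open>down T i\<close> only.
\<close>

record ('w, 'z) team =
  num_dms :: nat
  prob :: "'w measure"
  prim_set :: "nat \<Rightarrow> 'z set"
  prim :: "nat \<Rightarrow> 'w \<Rightarrow> 'z"
  act_dim :: "nat \<Rightarrow> nat"
  act_set :: "nat \<Rightarrow> rvec set"
  dyn_dim :: "nat \<Rightarrow> nat"
  dyn_set :: "nat \<Rightarrow> rvec set"
  stat_dim :: "nat \<Rightarrow> nat"
  stat_set :: "nat \<Rightarrow> rvec set"
  down :: "nat \<Rightarrow> nat set"
  prim_obs :: "nat \<Rightarrow> (nat \<Rightarrow> 'z) \<Rightarrow> rvec"
  obs_fun :: "nat \<Rightarrow> rvec \<Rightarrow> (nat \<Rightarrow> rvec) \<Rightarrow> rvec"
  cost :: "'z \<Rightarrow> (nat \<Rightarrow> rvec) \<Rightarrow> real"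

definition prim_space :: "('w, 'z::polish_space) team \<Rightarrow> nat \<Rightarrow> 'z measure" where
  "prim_space T i = restrict_space borel (prim_set T i)"

definition zeta_space :: "('w, 'z::polish_space) team \<Rightarrow> (nat \<Rightarrow> 'z) measure" where
  "zeta_space T = Pi\<^sub>M {0..num_dms T} (prim_space T)"

definition zeta :: "('w, 'z::polish_space) team \<Rightarrow> 'w \<Rightarrow> nat \<Rightarrow> 'z" where
  "zeta T w = (\<lambda>i\<in>{0..num_dms T}. prim T i w)"

definition act_space :: "('w, 'z::polish_space) team \<Rightarrow> nat \<Rightarrow> rvec measure" where
  "act_space T i = restrict_space (euclid (act_dim T i)) (act_set T i)"

definition dyn_space :: "('w, 'z::polish_space) team \<Rightarrow> nat \<Rightarrow> rvec measure" where
  "dyn_space T i = restrict_space (euclid (dyn_dim T i)) (dyn_set T i)"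

definition stat_space :: "('w, 'z::polish_space) team \<Rightarrow> nat \<Rightarrow> rvec measure" where
  "stat_space T i = restrict_space (euclid (stat_dim T i)) (stat_set T i)"

text \<open>
  \<open>u\<^sup>j\<close> has an effect on the new observation of decision maker \<open>i\<close>. Since \<open>g\<^sub>i\<close> only receives the actions
  indexed by \<open>down T i\<close>, requiring this of all \<open>j \<in> down T i\<close> makes \<open>down T i\<close>
  exactly the set of those whose action affects that observation.
\<close>

definition affects :: "('w, 'z::polish_space) team \<Rightarrow> nat \<Rightarrow> nat \<Rightarrow> bool" where
  "affects T j i \<longleftrightarrow>
     (\<exists>w\<in>space (prob T). \<exists>u\<in>space (Pi\<^sub>M (down T i) (act_space T)). \<exists>v\<in>act_set T j.
        obs_fun T i (prim_obs T i (zeta T w)) (u(j := v))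
          \<noteq> obs_fun T i (prim_obs T i (zeta T w)) u)"

definition valid_team :: "('w, 'z::polish_space) team \<Rightarrow> bool" where
  "valid_team T \<longleftrightarrow>
     1 \<le> num_dms T \<and>
     prob_space (prob T) \<and>
     (\<forall>i\<in>{0..num_dms T}.
        prim_set T i \<in> sets borel \<and> prim T i \<in> prob T \<rightarrow>\<^sub>M prim_space T i) \<and>
     (\<forall>i\<in>{1..num_dms T}.
        1 \<le> act_dim T i \<and> act_set T i \<in> sets (euclid (act_dim T i)) \<and>
        1 \<le> dyn_dim T i \<and> dyn_set T i \<in> sets (euclid (dyn_dim T i)) \<and>
        1 \<le> stat_dim T i \<and> stat_set T i \<in> sets (euclid (stat_dim T i)) \<and>
        down T i \<subseteq> {1..<i} \<and> (\<forall>j\<in>down T i. affects T j i) \<and>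
        prim_obs T i \<in> zeta_space T \<rightarrow>\<^sub>M stat_space T i \<and>
        (\<lambda>(x, u). obs_fun T i x u)
          \<in> stat_space T i \<Otimes>\<^sub>M Pi\<^sub>M (down T i) (act_space T) \<rightarrow>\<^sub>M dyn_space T i) \<and>
     (\<lambda>(x, u). cost T x u)
       \<in> borel_measurable (prim_space T 0 \<Otimes>\<^sub>M Pi\<^sub>M {1..num_dms T} (act_space T)) \<and>
     (\<forall>x\<in>prim_set T 0. \<forall>u\<in>space (Pi\<^sub>M {1..num_dms T} (act_space T)). 0 \<le> cost T x u)"

text \<open>
  For every fixed \<open>u\<close>, \<open>g\<^sub>i(\<sqdot>, u)\<close> is a bijection between the two observation spaces of \<open>i\<close>. Both are
  standard Borel, so the inverse is automatically measurable.
\<close>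

definition invertible_obs :: "('w, 'z::polish_space) team \<Rightarrow> bool" where
  "invertible_obs T \<longleftrightarrow>
     (\<forall>i\<in>{1..num_dms T}. \<forall>u\<in>space (Pi\<^sub>M (down T i) (act_space T)).
        bij_betw (\<lambda>x. obs_fun T i x u) (stat_set T i) (dyn_set T i))"

text \<open>
  The recursive tuple \<open>y\<^sub>i = (y\<^bsub>\<down>i\<^esub>, yhat\<^sub>i)\<close> is flattened: \<open>y\<^sub>i\<close> is the family of those new observations
  \<open>yhat\<^sub>k\<close> that occur in it. Their indices are the \<open>k\<close> from which \<open>i\<close> is reached by finitely many
  (possibly no) steps \<open>j \<in> down T l\<close>. The static and the dynamic team have the same index sets.
\<close>

definition info :: "('w, 'z::polish_space) team \<Rightarrow> nat \<Rightarrow> nat set" where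
  "info T i = {k. (k, i) \<in> {(j, l). j \<in> down T l}\<^sup>*}"

datatype problem = Dynamic | Static

definition info_space :: "('w, 'z::polish_space) team \<Rightarrow> problem \<Rightarrow> nat \<Rightarrow> (nat \<Rightarrow> rvec) measure" where
  "info_space T p i =
     Pi\<^sub>M (info T i) (case p of Dynamic \<Rightarrow> dyn_space T | Static \<Rightarrow> stat_space T)"

type_synonym policy = "nat \<Rightarrow> (nat \<Rightarrow> rvec) \<Rightarrow> rvec"

definition admissible ::
  "('w, 'z::polish_space) team \<Rightarrow> problem \<Rightarrow> nat \<Rightarrow> ((nat \<Rightarrow> rvec) \<Rightarrow> rvec) set" where
  "admissible T p i = info_space T p i \<rightarrow>\<^sub>M act_space T i"

definition policies :: "('w, 'z::polish_space) team \<Rightarrow> problem \<Rightarrow> policy set" where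
  "policies T p = {\<gamma>. \<forall>i\<in>{1..num_dms T}. \<gamma> i \<in> admissible T p i}"

text \<open>
  \<open>dyn_obs_upto T \<gamma> z n\<close> holds the new observations of decision makers \<open>1, \<dots>, n\<close> in the dynamic team
  at \<open>\<zeta> = z\<close>, when all of them use \<open>\<gamma>\<close>.
\<close>

primrec dyn_obs_upto ::
  "('w, 'z::polish_space) team \<Rightarrow> policy \<Rightarrow> (nat \<Rightarrow> 'z) \<Rightarrow> nat \<Rightarrow> nat \<Rightarrow> rvec" where
  "dyn_obs_upto T \<gamma> z 0 = (\<lambda>_. undefined)"
| "dyn_obs_upto T \<gamma> z (Suc n) =
     (dyn_obs_upto T \<gamma> z n)
       (Suc n := obs_fun T (Suc n) (prim_obs T (Suc n) z)
          (\<lambda>j\<in>down T (Suc n). \<gamma> j (restrict (dyn_obs_upto T \<gamma> z n) (info T j))))"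

definition obs ::
  "('w, 'z::polish_space) team \<Rightarrow> problem \<Rightarrow> policy \<Rightarrow> (nat \<Rightarrow> 'z) \<Rightarrow> nat \<Rightarrow> nat \<Rightarrow> rvec" where
  "obs T p \<gamma> z i =
     restrict (case p of Dynamic \<Rightarrow> dyn_obs_upto T \<gamma> z (num_dms T)
                       | Static \<Rightarrow> (\<lambda>k. prim_obs T k z)) (info T i)"

definition actions ::
  "('w, 'z::polish_space) team \<Rightarrow> problem \<Rightarrow> policy \<Rightarrow> (nat \<Rightarrow> 'z) \<Rightarrow> nat \<Rightarrow> rvec" where
  "actions T p \<gamma> z = (\<lambda>i\<in>{1..num_dms T}. \<gamma> i (obs T p \<gamma> z i))"

definition incurred_cost ::
  "('w, 'z::polish_space) team \<Rightarrow> problem \<Rightarrow> policy \<Rightarrow> (nat \<Rightarrow> 'z) \<Rightarrow> ennreal" where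
  "incurred_cost T p \<gamma> z = ennreal (cost T (z 0) (actions T p \<gamma> z))"

definition expected_cost :: "('w, 'z::polish_space) team \<Rightarrow> problem \<Rightarrow> policy \<Rightarrow> ennreal" where
  "expected_cost T p \<gamma> = (\<integral>\<^sup>+ w. incurred_cost T p \<gamma> (zeta T w) \<partial>prob T)"

definition pbp_optimal :: "('w, 'z::polish_space) team \<Rightarrow> problem \<Rightarrow> policy \<Rightarrow> bool" where
  "pbp_optimal T p \<gamma> \<longleftrightarrow>
     (\<forall>i\<in>{1..num_dms T}.
        expected_cost T p \<gamma> = (INF \<beta>\<in>admissible T p i. expected_cost T p (\<gamma>(i := \<beta>))))"

definition dist_vec :: "nat \<Rightarrow> rvec \<Rightarrow> rvec \<Rightarrow> real" where
  "dist_vec n u v = L2_set (\<lambda>k. v k - u k) {..<n}"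

text \<open>
  \<open>F\<close>, a function on \<open>U \<subseteq> \<real>\<^sup>n\<close>, is finite near \<open>u\<close> and Frechet differentiable at \<open>u\<close> with gradient \<open>G\<close>.
  In particular \<open>u\<close> is interior to \<open>U\<close>: there is no gradient at boundary or isolated points.
\<close>

definition has_gradient :: "nat \<Rightarrow> rvec set \<Rightarrow> (rvec \<Rightarrow> ennreal) \<Rightarrow> rvec \<Rightarrow> rvec \<Rightarrow> bool" where
  "has_gradient n U F G u \<longleftrightarrow>
     (\<forall>e>0. \<exists>d>0. \<forall>v\<in>space (euclid n). dist_vec n u v < d \<longrightarrow>
        v \<in> U \<and> F v < \<infinity> \<and>
        \<bar>enn2real (F v) - enn2real (F u) - (\<Sum>k<n. G k * (v k - u k))\<bar> \<le> e * dist_vec n u v)"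

text \<open>
  \<open>K\<close> is a regular conditional distribution of the \<open>A\<close>-valued \<open>X\<close> given the \<open>B\<close>-valued \<open>Y\<close>.
\<close>

definition regular_cond_distr ::
  "'w measure \<Rightarrow> 'a measure \<Rightarrow> ('w \<Rightarrow> 'a) \<Rightarrow> 'b measure \<Rightarrow> ('w \<Rightarrow> 'b) \<Rightarrow> ('b \<Rightarrow> 'a measure) \<Rightarrow> bool" where
  "regular_cond_distr M A X B Y K \<longleftrightarrow>
     K \<in> B \<rightarrow>\<^sub>M prob_algebra A \<and>
     (\<forall>S\<in>sets A. AE w in M.
        emeasure (K (Y w)) S
          = nn_cond_exp M (vimage_algebra (space M) Y B) (\<lambda>w. indicator S (X w)) w)"

text \<open>
  In \<open>u \<mapsto> E[c(\<omega>\<^sub>0, (\<gamma>\<^sub>-\<^sub>i, u)) | y\<^sub>i]\<close>, a separate choice of version of the conditional expectation for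
  each \<open>u\<close> would make the gradient meaningless, so the conditional expectation is taken with
  respect to a regular conditional distribution of \<open>\<zeta>\<close> given \<open>y\<^sub>i\<close>. As \<open>zeta_space T\<close> is standard Borel, this
  exists and is unique up to a null set. The policy \<open>\<gamma>(i := \<lambda>_. u)\<close> lets decision maker \<open>i\<close> apply \<open>u\<close>; in the
  dynamic problem the later observations then react to \<open>u\<close>.
\<close>

definition stationary :: "('w, 'z::polish_space) team \<Rightarrow> problem \<Rightarrow> policy \<Rightarrow> bool" where
  "stationary T p \<gamma> \<longleftrightarrow>
     (\<forall>i\<in>{1..num_dms T}. \<exists>K.
        regular_cond_distr (prob T) (zeta_space T) (zeta T)
          (info_space T p i) (\<lambda>w. obs T p \<gamma> (zeta T w) i) K \<and>
        (AE w in prob T.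
           has_gradient (act_dim T i) (act_set T i)
             (\<lambda>u. \<integral>\<^sup>+ z. incurred_cost T p (\<gamma>(i := \<lambda>_. u)) z \<partial>K (obs T p \<gamma> (zeta T w) i))
             (\<lambda>_. 0)
             (\<gamma> i (obs T p \<gamma> (zeta T w) i))))"

definition related_by_reduction ::
  "('w, 'z::polish_space) team \<Rightarrow> policy \<Rightarrow> policy \<Rightarrow> bool" where
  "related_by_reduction T \<gamma>D \<gamma>S \<longleftrightarrow>
     (\<forall>i\<in>{1..num_dms T}. AE w in prob T.
        \<gamma>S i (obs T Static \<gamma>S (zeta T w) i) = \<gamma>D i (obs T Dynamic \<gamma>D (zeta T w) i))"

definition reduction_pair :: "('w, 'z::polish_space) team \<Rightarrow> policy \<Rightarrow> policy \<Rightarrow> bool" where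
  "reduction_pair T \<gamma>D \<gamma>S \<longleftrightarrow>
     valid_team T \<and> invertible_obs T \<and>
     \<gamma>D \<in> policies T Dynamic \<and> \<gamma>S \<in> policies T Static \<and> related_by_reduction T \<gamma>D \<gamma>S"

end

theory Submission
  imports Defs
begin

text \<open>
  Take a team without randomness in which the second decision maker observes the action
  \<open>a\<close> of the first (shifted by a constant signal \<open>0\<close>), and the cost is \<open>(1 + a (1 - c))\<^sup>2\<close> for actions
  \<open>a\<close>, \<open>c\<close>. The first decision maker plays \<open>0\<close>; the second plays \<open>b\<close> if the observation is \<open>0\<close> and
  \<open>1 - b\<close> otherwise, where \<open>b\<close> is \<open>0\<close> or \<open>1\<close>. The actions are \<open>(0, b)\<close> and the cost is \<open>1\<close>, whatever
  the second decision maker does. A deviation of the first one to \<open>a\<close> costs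
  \<open>(1 + a (1 - b))\<^sup>2\<close> if the second cannot see it and, for \<open>a \<noteq> 0\<close>, \<open>(1 + a b)\<^sup>2\<close> if the second can. So for
  \<open>b = 0\<close> deviating matters only in the static team, and for \<open>b = 1\<close> only in the dynamic one.
\<close>

definition vec1 :: "real \<Rightarrow> rvec" where
  "vec1 a = (\<lambda>_\<in>{..<1}. a)"

text \<open>The constant signal enters the second observation additively so that, for every fixed
  action, the observation is a translation of the signal.\<close>

definition signalling_team :: "(real, real) team" where
  "signalling_team =
     \<lparr>num_dms = 2, prob = return borel 0, prim_set = (\<lambda>_. UNIV), prim = (\<lambda>_ _. 0),
      act_dim = (\<lambda>_. 1), act_set = (\<lambda>_. space (euclid 1)),
      dyn_dim = (\<lambda>_. 1), dyn_set = (\<lambda>_. space (euclid 1)),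
      stat_dim = (\<lambda>_. 1), stat_set = (\<lambda>_. space (euclid 1)),
      down = (\<lambda>i. if i = 2 then {1} else {}),
      prim_obs = (\<lambda>_ _. vec1 0),
      obs_fun = (\<lambda>i x u. if i = 2 then vec1 (x 0 + u 1 0) else x),
      cost = (\<lambda>_ u. (1 + u 1 0 * (1 - u 2 0))\<^sup>2)\<rparr>"

text \<open>
  Both teams have the same observation spaces, so the same functions serve as policies in both.
\<close>

definition switching_policy :: "real \<Rightarrow> policy" where
  "switching_policy b i y = vec1 (if i = 2 then if y 2 0 = 0 then b else 1 - b else 0)"

lemma signalling_team_simps [simp]:
  "num_dms signalling_team = 2"
  "prob signalling_team = return borel 0"
  "prim_set signalling_team i = UNIV"
  "prim signalling_team i = (\<lambda>_. 0)"
  "act_dim signalling_team i = 1"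
  "act_set signalling_team i = space (euclid 1)"
  "dyn_dim signalling_team i = 1"
  "dyn_set signalling_team i = space (euclid 1)"
  "stat_dim signalling_team i = 1"
  "stat_set signalling_team i = space (euclid 1)"
  "down signalling_team i = (if i = 2 then {1} else {})"
  "prim_obs signalling_team i = (\<lambda>_. vec1 0)"
  "obs_fun signalling_team i = (\<lambda>x u. if i = 2 then vec1 (x 0 + u 1 0) else x)"
  "cost signalling_team = (\<lambda>_ u. (1 + u 1 0 * (1 - u 2 0))\<^sup>2)"
  by (simp_all add: signalling_team_def)

section \<open>The spaces of the team: \<open>borel\<close> and \<open>euclid 1\<close>\<close>

lemma restrict_space_space: "restrict_space M (space M) = M"
proof (rule measure_eqI)
  show sets: "sets (restrict_space M (space M)) = sets M"
    using sets.sets_into_space by (fastforce simp: set_eq_iff sets_restrict_space_iff)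
  show "emeasure (restrict_space M (space M)) A = emeasure M A"
    if "A \<in> sets (restrict_space M (space M))" for A
    using that sets by (intro emeasure_restrict_space) (auto dest: sets.sets_into_space)
qed

lemma spaces_signalling_team [simp]:
  "act_space signalling_team = (\<lambda>_. euclid 1)"
  "dyn_space signalling_team = (\<lambda>_. euclid 1)"
  "stat_space signalling_team = (\<lambda>_. euclid 1)"
  "prim_space signalling_team = (\<lambda>_. borel)"
  using restrict_space_space [of borel]
  by (simp_all add: fun_eq_iff act_space_def dyn_space_def stat_space_def prim_space_def
      restrict_space_space)

lemma vec1_0 [simp]: "vec1 a 0 = a"
  by (simp add: vec1_def)

lemma vec1_in_space [simp]: "vec1 a \<in> space (euclid (Suc 0))"
  by (auto simp: vec1_def euclid_def space_PiM)

lemma space_euclid_1_eq: "v \<in> space (euclid 1) \<Longrightarrow> v = vec1 (v 0)"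
  by (auto simp: vec1_def euclid_def space_PiM fun_eq_iff PiE_def extensional_def)

lemma measurable_vec1 [measurable]: "f \<in> borel_measurable M \<Longrightarrow> (\<lambda>x. vec1 (f x)) \<in> M \<rightarrow>\<^sub>M euclid 1"
  unfolding vec1_def euclid_def by measurable

lemma measurable_euclid_component:
  assumes "f \<in> M \<rightarrow>\<^sub>M euclid n" "0 < n"
  shows "(\<lambda>x. f x 0) \<in> borel_measurable M"
  using measurable_compose [OF assms(1) [unfolded euclid_def] measurable_component_singleton] assms(2)
  by simp

lemma measurable_PiM_euclid_component:
  assumes "f \<in> M \<rightarrow>\<^sub>M Pi\<^sub>M I (\<lambda>_. euclid n)" "i \<in> I" "0 < n"
  shows "(\<lambda>x. f x i 0) \<in> borel_measurable M"
  by (rule measurable_euclid_component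
      [OF measurable_compose [OF assms(1) measurable_component_singleton [OF assms(2)]] assms(3)])

lemma dist_vec_vec1: "dist_vec 1 (vec1 a) (vec1 b) = \<bar>b - a\<bar>"
  by (simp add: dist_vec_def L2_set_def lessThan_Suc)

lemma has_gradient_const:
  assumes "\<And>v. v \<in> space (euclid n) \<Longrightarrow> F v = c" "c < \<infinity>" "u \<in> space (euclid n)"
  shows "has_gradient n (space (euclid n)) F (\<lambda>_. 0) u"
  using assms by (auto simp: has_gradient_def dist_vec_def L2_set_nonneg intro!: exI[of _ 1])

section \<open>Information, observations and cost\<close>

lemma info_signalling_team:
  "info signalling_team (Suc 0) = {Suc 0}" "info signalling_team 2 = {Suc 0, 2}"
proof -
  have "{(j, l). j \<in> down signalling_team l} = {(Suc 0, 2)}"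
    by auto
  moreover have "(k, i) \<in> {(Suc 0, 2)}\<^sup>* \<longleftrightarrow> k = i \<or> k = Suc 0 \<and> i = 2" for k i :: nat
    by (auto elim: rtranclE converse_rtranclE)
  ultimately show "info signalling_team (Suc 0) = {Suc 0}" "info signalling_team 2 = {Suc 0, 2}"
    unfolding info_def by auto
qed

lemma info_space_signalling_team:
  "info_space signalling_team p i = Pi\<^sub>M (info signalling_team i) (\<lambda>_. euclid 1)"
  by (simp add: info_space_def split: problem.split)

definition signal1 :: "nat \<Rightarrow> rvec" where
  "signal1 = (\<lambda>_\<in>{1}. vec1 0)"

definition signal2 :: "real \<Rightarrow> nat \<Rightarrow> rvec" where
  "signal2 s = (\<lambda>k\<in>{1, 2}. vec1 (if k = 2 then s else 0))"

lemma obs_signalling_team: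
  "obs signalling_team p \<gamma> z (Suc 0) = signal1"
  "obs signalling_team p \<gamma> z 2 =
     signal2 (case p of Dynamic \<Rightarrow> \<gamma> 1 signal1 0 | Static \<Rightarrow> 0)"
proof -
  have upto1: "dyn_obs_upto signalling_team \<gamma> z (Suc 0) (Suc 0) = vec1 0"
    by simp
  then have "restrict (dyn_obs_upto signalling_team \<gamma> z (Suc 0)) {Suc 0} = signal1"
    by (auto simp: signal1_def simp del: dyn_obs_upto.simps)
  \<comment> \<open>One unfolding of the recursion: the first decision maker acts on
    \<open>signal1\<close>, and the signal \<open>0\<close> plus that action is the new
    observation.\<close>
  then have "dyn_obs_upto signalling_team \<gamma> z 2 =
      (dyn_obs_upto signalling_team \<gamma> z (Suc 0))(2 := vec1 (\<gamma> 1 signal1 0))"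
    using dyn_obs_upto.simps(2) [of signalling_team \<gamma> z "Suc 0"]
    by (simp add: info_signalling_team Suc_1 [unfolded One_nat_def] del: dyn_obs_upto.simps)
  with upto1 show "obs signalling_team p \<gamma> z (Suc 0) = signal1"
    "obs signalling_team p \<gamma> z 2 =
       signal2 (case p of Dynamic \<Rightarrow> \<gamma> 1 signal1 0 | Static \<Rightarrow> 0)"
    by (auto simp: obs_def info_signalling_team signal1_def signal2_def restrict_def
        simp del: dyn_obs_upto.simps split: problem.split)
qed

text \<open>This reduces both problems to real arithmetic: \<open>z\<close> drops out, and they
  differ only in what the second decision maker sees.\<close>

lemma incurred_cost_signalling_team:
  "incurred_cost signalling_team p \<gamma> z =
     ennreal ((1 + \<gamma> 1 signal1 0 *
       (1 - \<gamma> 2 (signal2 (case p of Dynamic \<Rightarrow> \<gamma> 1 signal1 0 | Static \<Rightarrow> 0)) 0))\<^sup>2)"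
  by (simp add: incurred_cost_def actions_def obs_signalling_team)

lemma expected_cost_signalling_team:
  "expected_cost signalling_team p \<gamma> = incurred_cost signalling_team p \<gamma> z"
proof -
  interpret prob_space "return borel (0 :: real)"
    by (simp add: prob_space_return)
  show ?thesis
    by (simp add: expected_cost_def incurred_cost_signalling_team emeasure_space_1)
qed

lemma obs_in_space:
  "i \<in> {1, 2} \<Longrightarrow> obs signalling_team p \<gamma> z i \<in> space (info_space signalling_team p i)"
  by (auto simp: info_space_signalling_team info_signalling_team obs_signalling_team signal1_def
      signal2_def space_PiM)

lemma atLeastAtMost_1_2: "{Suc 0..2} = {Suc 0, 2}"
  by auto

section \<open>Validity, invertibility and the static reduction\<close>

lemma valid_signalling_team: "valid_team signalling_team"
proof -
  have "affects signalling_team 1 2"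
    unfolding affects_def
    \<comment> \<open>Replacing the action \<open>0\<close> by \<open>1\<close> moves the
      observation from \<open>vec1 0\<close> to \<open>vec1 1\<close>.\<close>
    by (intro bexI[of _ 0] bexI[of _ "\<lambda>_\<in>{1}. vec1 0"] bexI[of _ "vec1 1"])
      (auto simp: space_PiM dest: fun_cong[of _ _ 0])
  moreover have "(\<lambda>(x, u). vec1 (x 0 + u 1 0)) \<in> euclid 1 \<Otimes>\<^sub>M Pi\<^sub>M {1 :: nat} (\<lambda>_. euclid 1) \<rightarrow>\<^sub>M euclid 1"
    unfolding case_prod_beta
    by (intro measurable_vec1 borel_measurable_add measurable_euclid_component [OF measurable_fst]
        measurable_PiM_euclid_component [OF measurable_snd]) simp_all
  moreover have "(\<lambda>(x, u). (1 + u 1 0 * (1 - u 2 0))\<^sup>2)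
      \<in> borel_measurable (borel \<Otimes>\<^sub>M Pi\<^sub>M {1..2 :: nat} (\<lambda>_. euclid 1))"
    unfolding case_prod_beta
    by (intro borel_measurable_power borel_measurable_add borel_measurable_times
        borel_measurable_diff borel_measurable_const
        measurable_PiM_euclid_component [OF measurable_snd]) simp_all
  ultimately show ?thesis
    unfolding valid_team_def by (auto simp: prob_space_return measurable_const)
qed

lemma invertible_signalling_team: "invertible_obs signalling_team"
proof -
  \<comment> \<open>For the second decision maker \<open>a\<close> is the observed action; for the
    first the map is the identity.\<close>
  have "bij_betw (\<lambda>x. vec1 (x 0 + a)) (space (euclid 1)) (space (euclid 1))" for a
    by (rule bij_betwI[where g = "\<lambda>x. vec1 (x 0 - a)"]) (auto simp: space_euclid_1_eq [symmetric])
  then show ?thesis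
    by (auto simp: invertible_obs_def bij_betw_def)
qed

lemma const_admissible: "(\<lambda>_. vec1 a) \<in> admissible signalling_team p i"
  by (simp add: admissible_def)

lemma switching_policy_in_policies: "switching_policy b \<in> policies signalling_team p"
proof -
  have [measurable]: "(\<lambda>y. y 2 0) \<in> borel_measurable (Pi\<^sub>M {Suc 0, 2} (\<lambda>_. euclid 1))"
    by (rule measurable_PiM_euclid_component [OF measurable_ident_sets]) auto
  have "(\<lambda>y. vec1 (if y 2 0 = 0 then b else 1 - b)) \<in> Pi\<^sub>M {Suc 0, 2} (\<lambda>_. euclid 1) \<rightarrow>\<^sub>M euclid 1"
    by measurable
  then show ?thesis
    by (auto simp: policies_def admissible_def info_space_signalling_team info_signalling_team
        atLeastAtMost_1_2 switching_policy_def [abs_def])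
qed

text \<open>The first decision maker plays \<open>0\<close>, so the second observes \<open>0\<close>
  in the dynamic team just as in the static one, and the same functions produce the same
  actions.\<close>

lemma reduction_pair_switching_policy:
  "reduction_pair signalling_team (switching_policy b) (switching_policy b)"
  by (auto simp: reduction_pair_def valid_signalling_team invertible_signalling_team
      switching_policy_in_policies related_by_reduction_def atLeastAtMost_1_2 obs_signalling_team
      switching_policy_def split: problem.split)

section \<open>Optimality and stationarity when no deviation changes the cost\<close>

text \<open>The indicator of a constant is constant, so it is measurable for every sub-sigma-algebra
  and is its own conditional expectation.\<close>

lemma regular_cond_distr_const:
  assumes "prob_space M" "x \<in> space A" "y \<in> space B"
  shows "regular_cond_distr M A (\<lambda>_. x) B (\<lambda>_. y) (\<lambda>_. return A x)"
proof -
  interpret prob_space M by fact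
  have "subalgebra M (vimage_algebra (space M) (\<lambda>_. y) B)"
    using assms(3) by (auto simp: subalgebra_def sets_vimage_algebra2 vimage_def)
  then interpret finite_measure_subalgebra M "vimage_algebra (space M) (\<lambda>_. y) B"
    by unfold_locales
  have "AE w in M. indicator S x = nn_cond_exp M (vimage_algebra (space M) (\<lambda>_. y) B) (\<lambda>_. indicator S x) w"
    for S
    by (rule nn_cond_exp_F_meas) simp
  then show ?thesis
    using assms(2) by (auto simp: regular_cond_distr_def prob_space_return intro!: measurable_const
        simp: space_prob_algebra)
qed

lemma regular_cond_distr_signalling_team:
  assumes "i \<in> {1, 2}"
  shows "regular_cond_distr (prob signalling_team) (zeta_space signalling_team) (zeta signalling_team)
    (info_space signalling_team p i) (\<lambda>w. obs signalling_team p \<gamma> (zeta signalling_team w) i)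
    (\<lambda>_. return (zeta_space signalling_team) (\<lambda>_\<in>{0..2}. 0))"
proof -
  have "zeta signalling_team = (\<lambda>_. \<lambda>_\<in>{0..2}. 0)"
    by (auto simp: zeta_def fun_eq_iff)
  moreover have "(\<lambda>_\<in>{0..2}. 0) \<in> space (zeta_space signalling_team)"
    by (auto simp: zeta_space_def space_PiM)
  ultimately show ?thesis
    using obs_in_space [OF assms] by (simp add: regular_cond_distr_const prob_space_return)
qed

lemma pbp_optimal_if_cost_const:
  assumes "\<gamma> \<in> policies signalling_team p"
    and "\<And>i \<beta> z. i \<in> {1, 2} \<Longrightarrow> incurred_cost signalling_team p (\<gamma>(i := \<beta>)) z = c"
  shows "pbp_optimal signalling_team p \<gamma>"
proof -
  have "expected_cost signalling_team p (\<gamma>(i := \<beta>)) = c" if "i \<in> {1, 2}" for i \<beta>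
    using assms(2) [OF that] by (simp add: expected_cost_signalling_team [where z = undefined])
  \<comment> \<open>Updating \<open>\<gamma>\<close> at \<open>1\<close> with
    \<open>\<gamma> 1\<close> gives \<open>\<gamma>\<close> back.\<close>
  moreover from this [of 1 "\<gamma> 1"] have "expected_cost signalling_team p \<gamma> = c"
    by simp
  \<comment> \<open>Over an empty set the infimum would be infinite instead of
    \<open>c\<close>.\<close>
  moreover have "admissible signalling_team p i \<noteq> {}" for i
    using const_admissible by blast
  ultimately show ?thesis
    by (simp add: pbp_optimal_def atLeastAtMost_1_2)
qed

text \<open>Integrating the constant cost against the Dirac kernel leaves a constant function of the
  action, whose gradient is zero.\<close>

lemma stationary_if_cost_const:
  assumes "\<gamma> \<in> policies signalling_team p" "c < \<infinity>"
    and "\<And>i \<beta> z. i \<in> {1, 2} \<Longrightarrow> incurred_cost signalling_team p (\<gamma>(i := \<beta>)) z = c"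
  shows "stationary signalling_team p \<gamma>"
proof -
  define K where "K = return (zeta_space signalling_team) (\<lambda>_\<in>{0..2}. 0)"
  interpret K: prob_space K
    unfolding K_def by (rule prob_space_return) (auto simp: zeta_space_def space_PiM)
  have "regular_cond_distr (prob signalling_team) (zeta_space signalling_team) (zeta signalling_team)
      (info_space signalling_team p i) (\<lambda>w. obs signalling_team p \<gamma> (zeta signalling_team w) i) (\<lambda>_. K)"
    and "has_gradient 1 (space (euclid 1))
      (\<lambda>u. \<integral>\<^sup>+ z. incurred_cost signalling_team p (\<gamma>(i := \<lambda>_. u)) z \<partial>K)
      (\<lambda>_. 0) (\<gamma> i (obs signalling_team p \<gamma> (zeta signalling_team w) i))"
    if i: "i \<in> {1, 2}" for i w
  proof -
    show "regular_cond_distr (prob signalling_team) (zeta_space signalling_team) (zeta signalling_team)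
        (info_space signalling_team p i) (\<lambda>w. obs signalling_team p \<gamma> (zeta signalling_team w) i) (\<lambda>_. K)"
      unfolding K_def using i by (rule regular_cond_distr_signalling_team)
    have "\<gamma> i \<in> info_space signalling_team p i \<rightarrow>\<^sub>M euclid 1"
      using assms(1) i by (auto simp: policies_def admissible_def)
    then have "\<gamma> i (obs signalling_team p \<gamma> (zeta signalling_team w) i) \<in> space (euclid 1)"
      by (rule measurable_space) (rule obs_in_space [OF i])
    then show "has_gradient 1 (space (euclid 1))
        (\<lambda>u. \<integral>\<^sup>+ z. incurred_cost signalling_team p (\<gamma>(i := \<lambda>_. u)) z \<partial>K)
        (\<lambda>_. 0) (\<gamma> i (obs signalling_team p \<gamma> (zeta signalling_team w) i))"
      using assms(2) by (intro has_gradient_const [where c = c])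
        (simp_all only: assms(3) [OF i] nn_integral_const K.emeasure_space_1 mult_1_right)
  qed
  then show ?thesis
    unfolding stationary_def
    by (intro ballI exI [of _ "\<lambda>_. K"] conjI AE_I2) (simp_all add: atLeastAtMost_1_2)
qed

section \<open>Deviations from the switching policy\<close>

text \<open>The product in the cost always vanishes. If the second decision maker deviates, the
  first still plays \<open>0\<close>. If the first deviates to a nonzero action, the second plays
  \<open>1\<close>: for \<open>b = 0\<close> because it sees the change, for \<open>b = 1\<close>
  because it does not.\<close>

lemma cost_const_switching_policy:
  assumes "i \<in> {1, 2}" "(p, b) \<in> {(Dynamic, 0), (Static, 1)}"
  shows "incurred_cost signalling_team p ((switching_policy b)(i := \<beta>)) z = 1"
  using assms by (auto simp: incurred_cost_signalling_team switching_policy_def signal2_def)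

text \<open>Here the second decision maker answers with \<open>0\<close>: for \<open>b = 1\<close>
  by switching, for \<open>b = 0\<close> by not noticing.\<close>

lemma cost_deviation_switching_policy:
  assumes "(p, b) \<in> {(Dynamic, 1), (Static, 0)}" "p = Dynamic \<Longrightarrow> a \<noteq> 0"
  shows "incurred_cost signalling_team p ((switching_policy b)(1 := \<lambda>_. vec1 a)) z = ennreal ((1 + a)\<^sup>2)"
  using assms by (auto simp: incurred_cost_signalling_team switching_policy_def signal2_def)

lemma not_pbp_optimal_switching_policy:
  assumes "(p, b) \<in> {(Dynamic, 1), (Static, 0)}"
  shows "\<not> pbp_optimal signalling_team p (switching_policy b)"
proof
  assume "pbp_optimal signalling_team p (switching_policy b)"
  then have "expected_cost signalling_team p (switching_policy b) =
      (INF \<beta>\<in>admissible signalling_team p 1.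
        expected_cost signalling_team p ((switching_policy b)(1 := \<beta>)))"
    by (simp add: pbp_optimal_def)
  \<comment> \<open>The action \<open>- 1\<close> is the zero of \<open>(1 + a)\<^sup>2\<close>;
    being nonzero, it is noticed in the dynamic team.\<close>
  also have "\<dots> \<le> expected_cost signalling_team p ((switching_policy b)(1 := \<lambda>_. vec1 (- 1)))"
    by (intro INF_lower const_admissible)
  also have "\<dots> = 0"
    using cost_deviation_switching_policy [OF assms, of "- 1"]
    by (simp add: expected_cost_signalling_team [where z = undefined] del: fun_upd_apply)
  also have "expected_cost signalling_team p (switching_policy b) = 1"
    by (simp add: expected_cost_signalling_team [where z = undefined] incurred_cost_signalling_team
        switching_policy_def)
  finally show False
    by simp
qed

text \<open>Whatever kernel is chosen, the first decision maker's conditional cost is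
  \<open>(1 + a)\<^sup>2\<close>, with slope 2 at \<open>0\<close>.\<close>

lemma not_stationary_switching_policy:
  "\<not> stationary signalling_team Static (switching_policy 0)"
proof
  assume "stationary signalling_team Static (switching_policy 0)"
  moreover have "1 \<in> {1..num_dms signalling_team}"
    by simp
  ultimately obtain K where
    "regular_cond_distr (prob signalling_team) (zeta_space signalling_team) (zeta signalling_team)
      (info_space signalling_team Static 1)
      (\<lambda>w. obs signalling_team Static (switching_policy 0) (zeta signalling_team w) 1) K"
    and AE_grad: "AE w in prob signalling_team.
      has_gradient (act_dim signalling_team 1) (act_set signalling_team 1)
        (\<lambda>u. \<integral>\<^sup>+ z. incurred_cost signalling_team Static ((switching_policy 0)(1 := \<lambda>_. u)) z
          \<partial>K (obs signalling_team Static (switching_policy 0) (zeta signalling_team w) 1))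
        (\<lambda>_. 0)
        (switching_policy 0 1 (obs signalling_team Static (switching_policy 0) (zeta signalling_team w) 1))"
    unfolding stationary_def by blast
  then have "K \<in> info_space signalling_team Static 1 \<rightarrow>\<^sub>M prob_algebra (zeta_space signalling_team)"
    by (simp add: regular_cond_distr_def)
  moreover have "signal1 \<in> space (info_space signalling_team Static 1)"
    using obs_in_space [of 1 Static] by (simp add: obs_signalling_team)
  ultimately have "K signal1 \<in> space (prob_algebra (zeta_space signalling_team))"
    by (rule measurable_space)
  \<comment> \<open>Nothing more is needed of \<open>K\<close>, as the integrand below is constant in \<open>z\<close>.\<close>
  then interpret K: prob_space "K signal1"
    by (simp add: space_prob_algebra)
  define F where "F u = (\<integral>\<^sup>+ z. incurred_cost signalling_team Static
    ((switching_policy 0)(1 := \<lambda>_. u)) z \<partial>K signal1)" for u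
  have F: "enn2real (F (vec1 a)) = (1 + a)\<^sup>2" for a
    unfolding F_def by (subst nn_integral_cong [OF cost_deviation_switching_policy])
      (simp_all add: K.emeasure_space_1)
  interpret P: prob_space "prob signalling_team"
    by (simp add: prob_space_return)
  \<comment> \<open>The statement under \<open>AE\<close> does not depend on \<open>w\<close>, so it
    holds outright in a probability space.\<close>
  have "has_gradient 1 (space (euclid 1)) F (\<lambda>_. 0) (vec1 0)"
    using AE_grad
    by (simp add: F_def [abs_def] obs_signalling_team switching_policy_def [of _ "Suc 0"]
        del: signalling_team_simps(2))
  \<comment> \<open>The tolerance \<open>e = 1\<close> is taken below the slope 2.\<close>
  then obtain d where "d > 0" and
    d: "\<And>v. v \<in> space (euclid 1) \<Longrightarrow> dist_vec 1 (vec1 0) v < d \<Longrightarrow>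
      \<bar>enn2real (F v) - enn2real (F (vec1 0))\<bar> \<le> dist_vec 1 (vec1 0) v"
    unfolding has_gradient_def by (auto dest!: spec [of _ 1])
  \<comment> \<open>The increment \<open>d + d * d / 4\<close> would be at most the distance
    \<open>d / 2\<close>; rearranging and doubling gives the claim.\<close>
  from d [of "vec1 (d / 2)"] \<open>d > 0\<close> have "d + d * d / 2 \<le> 0"
    unfolding dist_vec_vec1 F by (simp add: power2_eq_square algebra_simps)
  with \<open>d > 0\<close> mult_pos_pos [of d d] show False
    by linarith
qed

theorem proposition4p1:
  shows
    "(\<exists>(T :: (real, real) team) \<gamma>D \<gamma>S. reduction_pair T \<gamma>D \<gamma>S \<and>
        stationary T Dynamic \<gamma>D \<and> \<not> stationary T Static \<gamma>S) \<and>
     (\<exists>(T :: (real, real) team) \<gamma>D \<gamma>S. reduction_pair T \<gamma>D \<gamma>S \<and>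
        pbp_optimal T Dynamic \<gamma>D \<and> \<not> pbp_optimal T Static \<gamma>S) \<and>
     (\<exists>(T :: (real, real) team) \<gamma>D \<gamma>S. reduction_pair T \<gamma>D \<gamma>S \<and>
        stationary T Static \<gamma>S \<and> \<not> pbp_optimal T Dynamic \<gamma>D) \<and>
     (\<exists>(T :: (real, real) team) \<gamma>D \<gamma>S. reduction_pair T \<gamma>D \<gamma>S \<and>
        pbp_optimal T Static \<gamma>S \<and> \<not> pbp_optimal T Dynamic \<gamma>D)"
proof -
  have "stationary signalling_team p (switching_policy b)"
    and "pbp_optimal signalling_team p (switching_policy b)"
    if "(p, b) \<in> {(Dynamic, 0), (Static, 1)}" for p b
  proof -
    show "stationary signalling_team p (switching_policy b)"
      by (rule stationary_if_cost_const [OF switching_policy_in_policies _ cost_const_switching_policy])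
        (use that in simp_all)
    show "pbp_optimal signalling_team p (switching_policy b)"
      by (rule pbp_optimal_if_cost_const [OF switching_policy_in_policies cost_const_switching_policy])
        (use that in simp_all)
  qed
  \<comment> \<open>The first two conjuncts use \<open>b = 0\<close>, the last two
    \<open>b = 1\<close>.\<close>
  from this [of Dynamic 0] this [of Static 1] show ?thesis
    using reduction_pair_switching_policy [of 0] reduction_pair_switching_policy [of 1]
      not_pbp_optimal_switching_policy [of Dynamic 1] not_pbp_optimal_switching_policy [of Static 0]
      not_stationary_switching_policy
    by blast
qed

end
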